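(* Let $M$ be a complete $n$-dimensional Riemannian manifold, $f:M\to\mathbb{R}\cup\{+\infty\}$ a proper lower semicontinuous function, and $D:M\times M\to\mathbb{R}_+$ a quasi distance such that $D(\cdot,y)$ is continuous for each $y\in M$. Let $a,b>0$ and let $\{x^k\}_{k\ge 0}\subset M$ be a sequence with $x^0\in\mathrm{dom} f$ and $x^{k+1}\neq x^k$ for all $k$, such that: (1) $f(x^{k+1})+a D^2(x^{k+1},x^k)\le f(x^k)$ for each $k\in\mathbb{N}$; (2) for each $k\in\mathbb{N}$ there exists $w^{k+1}\in\partial f(x^{k+1})$ with $\|w^{k+1}\|\le b D(x^{k+1},x^k)$; (3) $f$ restricted to $\mathrm{dom} f$ is continuous; (4) if $\sum_{k=0}^{+\infty}D(x^{k+1},x^k)<+\infty$, then $\{x^k\}$ is convergent on $M$. Let $\tilde x\in M$ be an accumulation point of $\{x^k\}$, and assume that $f$ has the Kurdyka-Lojasiewicz property at $\tilde x$, with associated neighborhood $U$, $\eta\in(0,+\infty]$ and function $\varphi:[0,\eta)\to\mathbb{R}_+$. Let $\rho>0$ be such that $B_D(\tilde x,\rho)\subset U$. Then there exists $k_0\in\mathbb{N}$ such that $$\sum_{k=k_0}^{+\infty}D(x^{k+1},x^k)<+\infty .$$ Moreover, $f(x^k)\to f(\tilde x)$ as $k\to+\infty$, and the sequence $\{x^k\}$ converges to $\tilde x$, which is a critical point of $f$.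
   Context: $\mathbb{N}=\{0,1,2,\dots\}$. $\mathrm{dom} f=\{x\in M: f(x)<+\infty\}$; $f$ is proper if $\mathrm{dom} f\ne\emptyset$. Quasi distance: a map $D:M\times M\to\mathbb{R}_+$ such that (i) for all $x,y\in M$, $D(x,y)=D(y,x)=0\Leftrightarrow x=y$; (ii) $D(x,z)\le D(x,y)+D(y,z)$ for all $x,y,z\in M$. (Symmetry is not required.) $B_D(x,\epsilon)=\{y\in M: D(y,x)<\epsilon\}$. Subdifferentials: for a lower semicontinuous $f$ and $x\in\mathrm{dom} f$, the Fréchet subdifferential is $\hat\partial f(x)=\{dh_x: h\in C^1(M),\ f-h \text{ attains a local minimum at } x\}$, where $dh_x$ is identified with $\mathrm{grad}\,h(x)\in T_xM$ through the Riemannian metric; $\hat\partial f(x)=\emptyset$ if $x\notin\mathrm{dom} f$. The (limiting) subdifferential is $\partial f(x)=\{v\in T_xM:\exists (x^n,v^n)\in TM,\ v^n\in\hat\partial f(x^n),\ (x^n,v^n)\to(x,v)\text{ in }TM,\ f(x^n)\to f(x)\}$. A point $x$ is critical for $f$ if $0\in\partial f(x)$. $\mathrm{dom}\,\partial f=\{x:\partial f(x)\ne\emptyset\}$ and $dist(0,\partial f(x))=\inf\{\|v\|:v\in\partial f(x)\}$ (with $\inf\emptyset=+\infty$). Kurdyka-Lojasiewicz property at $\bar x\in\mathrm{dom}\,\partial f$: there exist $\eta\in(0,+\infty]$, a neighborhood $U$ of $\bar x$ and a continuous concave function $\varphi:[0,\eta)\to\mathbb{R}_+$ such that (i) $\varphi(0)=0$,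 $\varphi\in C^1(0,\eta)$ and $\varphi'(s)>0$ for all $s\in(0,\eta)$; (ii) for all $x\in U$ with $f(\bar x)<f(x)<f(\bar x)+\eta$, $\varphi'(f(x)-f(\bar x))\,dist(0,\partial f(x))\ge 1$. *)

theory Defs
  imports "HOL-Analysis.Analysis"
begin

section \<open>Differentiability in Euclidean space\<close>

text \<open>Class \<open>C\<close>-\<open>k\<close> on an open set \<open>S\<close>: all iterated directional derivatives of order at
  most \<open>k\<close> exist and are continuous, those of order less than \<open>k\<close> being totally
  differentiable. Meant for open \<open>S\<close> only.\<close>

fun Ck_on :: "nat \<Rightarrow> (real^'n) set \<Rightarrow> (real^'n \<Rightarrow> 'b::real_normed_vector) \<Rightarrow> bool" where
  "Ck_on 0 S F \<longleftrightarrow> continuous_on S F"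
| "Ck_on (Suc k) S F \<longleftrightarrow>
     (\<forall>p\<in>S. F differentiable (at p)) \<and>
     (\<forall>u. Ck_on k S (\<lambda>p. frechet_derivative F (at p) u))"

definition smooth_on :: "(real^'n) set \<Rightarrow> (real^'n \<Rightarrow> 'b::real_normed_vector) \<Rightarrow> bool" where
  "smooth_on S F \<longleftrightarrow> (\<forall>k. Ck_on k S F)"


section \<open>Smooth manifolds\<close>

text \<open>The manifold is the whole type \<open>'m\<close>; in the definitions below it carries the sort
  \<open>{t2_space, second_countable_topology}\<close> (Hausdorff and second countable) wherever this matters.
  A chart is a domain together with a coordinate map; values of the coordinate map outside the
  domain are irrelevant. The dimension is \<open>CARD('n)\<close>.\<close>

type_synonym ('m, 'n) chart = "'m set \<times> ('m \<Rightarrow> real^'n)"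

abbreviation chart_image :: "('m, 'n) chart \<Rightarrow> (real^'n) set" where
  "chart_image c \<equiv> snd c ` fst c"

abbreviation chart_inv :: "('m, 'n) chart \<Rightarrow> real^'n \<Rightarrow> 'm" where
  "chart_inv c \<equiv> inv_into (fst c) (snd c)"

definition is_chart :: "('m::topological_space, 'n::finite) chart \<Rightarrow> bool" where
  "is_chart c \<longleftrightarrow> open (fst c) \<and> open (chart_image c) \<and>
     homeomorphism (fst c) (chart_image c) (snd c) (chart_inv c)"

definition smooth_atlas ::
    "('m::{t2_space, second_countable_topology}, 'n::finite) chart set \<Rightarrow> bool" where
  "smooth_atlas A \<longleftrightarrow>
     (\<forall>c\<in>A. is_chart c) \<and> (\<Union>c\<in>A. fst c) = UNIV \<and>
     (\<forall>c\<in>A. \<forall>c'\<in>A. smooth_on (snd c ` (fst c \<inter> fst c')) (snd c' \<circ> chart_inv c))"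

definition charts_at :: "('m, 'n) chart set \<Rightarrow> 'm \<Rightarrow> ('m, 'n) chart set" where
  "charts_at A x = {c \<in> A. x \<in> fst c}"

definition C1_manifold :: "('m, 'n::finite) chart set \<Rightarrow> ('m \<Rightarrow> real) \<Rightarrow> bool" where
  "C1_manifold A h \<longleftrightarrow> (\<forall>c\<in>A. Ck_on 1 (chart_image c) (h \<circ> chart_inv c))"


section \<open>Tangent bundle\<close>

text \<open>A tangent vector at \<open>x\<close> is the family of its coordinate vectors in all charts at \<open>x\<close>,
  where coordinates in different charts are related by the derivative of the transition map.
  Outside the charts at \<open>x\<close> the family is zero, so that equality of tangent vectors is equality
  of families. The vector space operations are pointwise.\<close>

type_synonym ('m, 'n) tvec = "('m, 'n) chart \<Rightarrow> real^'n"

definition transition_deriv ::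
    "'m \<Rightarrow> ('m, 'n::finite) chart \<Rightarrow> ('m, 'n) chart \<Rightarrow> real^'n \<Rightarrow> real^'n" where
  "transition_deriv x c c' = frechet_derivative (snd c' \<circ> chart_inv c) (at (snd c x))"

definition tangent_space :: "('m, 'n::finite) chart set \<Rightarrow> 'm \<Rightarrow> ('m, 'n) tvec set" where
  "tangent_space A x =
     {v. (\<forall>c\<in>charts_at A x. \<forall>c'\<in>charts_at A x. v c' = transition_deriv x c c' (v c)) \<and>
         (\<forall>c. c \<notin> charts_at A x \<longrightarrow> v c = 0)}"

definition tvec_of ::
    "('m, 'n::finite) chart set \<Rightarrow> 'm \<Rightarrow> ('m, 'n) chart \<Rightarrow> real^'n \<Rightarrow> ('m, 'n) tvec" where
  "tvec_of A x c u = (\<lambda>c'. if c' \<in> charts_at A x then transition_deriv x c c' u else 0)"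

definition tvec_zero :: "('m, 'n::finite) tvec" where
  "tvec_zero = (\<lambda>c. 0)"

definition tvec_add :: "('m, 'n::finite) tvec \<Rightarrow> ('m, 'n) tvec \<Rightarrow> ('m, 'n) tvec" where
  "tvec_add v w = (\<lambda>c. v c + w c)"

definition tvec_scale :: "real \<Rightarrow> ('m, 'n::finite) tvec \<Rightarrow> ('m, 'n) tvec" where
  "tvec_scale r v = (\<lambda>c. r *\<^sub>R v c)"

definition tangent_bundle :: "('m, 'n::finite) chart set \<Rightarrow> ('m \<times> ('m, 'n) tvec) set" where
  "tangent_bundle A = Sigma UNIV (tangent_space A)"

text \<open>The topology making every bundle chart \<open>(x, v) \<mapsto> (snd c x, v c)\<close> a homeomorphism from
  the part of the bundle over the chart domain to \<open>chart_image c \<times> UNIV\<close>.\<close>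

definition tangent_bundle_topology ::
    "('m, 'n::finite) chart set \<Rightarrow> ('m \<times> ('m, 'n) tvec) topology" where
  "tangent_bundle_topology A = topology_generated_by
     {{(x, v) \<in> tangent_bundle A. x \<in> fst c \<and> (snd c x, v c) \<in> W} | c W. c \<in> A \<and> open W}"

text \<open>The derivative \<open>dh\<^sub>x\<close> as a linear form on the tangent space; by the chain rule it does not
  depend on the chosen chart.\<close>

definition differential ::
    "('m, 'n::finite) chart set \<Rightarrow> ('m \<Rightarrow> real) \<Rightarrow> 'm \<Rightarrow> ('m, 'n) tvec \<Rightarrow> real" where
  "differential A h x v =
     (let c = (SOME c. c \<in> charts_at A x)
      in frechet_derivative (h \<circ> chart_inv c) (at (snd c x)) (v c))"


section \<open>Complete Riemannian manifolds\<close>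

type_synonym ('m, 'n) metric = "'m \<Rightarrow> ('m, 'n) tvec \<Rightarrow> ('m, 'n) tvec \<Rightarrow> real"

definition riemannian_metric ::
    "('m::topological_space, 'n::finite) chart set \<Rightarrow> ('m, 'n) metric \<Rightarrow> bool" where
  "riemannian_metric A g \<longleftrightarrow>
     (\<forall>x. \<forall>v\<in>tangent_space A x. \<forall>w\<in>tangent_space A x.
        g x v w = g x w v \<and>
        (v \<noteq> tvec_zero \<longrightarrow> 0 < g x v v) \<and>
        (\<forall>r. g x (tvec_scale r v) w = r * g x v w) \<and>
        (\<forall>z\<in>tangent_space A x. g x (tvec_add v z) w = g x v w + g x z w)) \<and>
     (\<forall>c\<in>A. \<forall>u u'. smooth_on (chart_image c)
        (\<lambda>p. let x = chart_inv c p in g x (tvec_of A x c u) (tvec_of A x c u')))"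

definition tnorm :: "('m, 'n::finite) metric \<Rightarrow> 'm \<Rightarrow> ('m, 'n) tvec \<Rightarrow> real" where
  "tnorm g x v = sqrt (g x v v)"

definition piecewise_C1_curve ::
    "('m::topological_space, 'n::finite) chart set \<Rightarrow> (real \<Rightarrow> 'm) \<Rightarrow> bool" where
  "piecewise_C1_curve A \<gamma> \<longleftrightarrow> continuous_on {0..1} \<gamma> \<and>
     (\<forall>c\<in>A. \<forall>s t. 0 \<le> s \<and> s < t \<and> t \<le> 1 \<and> \<gamma> ` {s..t} \<subseteq> fst c \<longrightarrow>
        (snd c \<circ> \<gamma>) piecewise_C1_differentiable_on {s..t})"

text \<open>At the finitely many break points of the curve the value is immaterial.\<close>

definition velocity ::
    "('m, 'n::finite) chart set \<Rightarrow> (real \<Rightarrow> 'm) \<Rightarrow> real \<Rightarrow> ('m, 'n) tvec" where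
  "velocity A \<gamma> t =
     (\<lambda>c. if c \<in> charts_at A (\<gamma> t) then vector_derivative (snd c \<circ> \<gamma>) (at t) else 0)"

definition curve_length ::
    "('m, 'n::finite) chart set \<Rightarrow> ('m, 'n) metric \<Rightarrow> (real \<Rightarrow> 'm) \<Rightarrow> ennreal" where
  "curve_length A g \<gamma> =
     (\<integral>\<^sup>+t\<in>{0..1}. ennreal (tnorm g (\<gamma> t) (velocity A \<gamma> t)) \<partial>lborel)"

text \<open>The distance is infinite between different connected components, as \<open>Inf {} = \<top>\<close>.\<close>

definition riemannian_dist ::
    "('m::topological_space, 'n::finite) chart set \<Rightarrow> ('m, 'n) metric \<Rightarrow> 'm \<Rightarrow> 'm \<Rightarrow> ennreal" where
  "riemannian_dist A g x y =
     Inf {curve_length A g \<gamma> | \<gamma>. piecewise_C1_curve A \<gamma> \<and> \<gamma> 0 = x \<and> \<gamma> 1 = y}"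

definition complete_riemannian_manifold ::
    "('m::{t2_space, second_countable_topology}, 'n::finite) chart set \<Rightarrow> ('m, 'n) metric \<Rightarrow> bool"
  where
  "complete_riemannian_manifold A g \<longleftrightarrow>
     smooth_atlas A \<and> riemannian_metric A g \<and>
     (\<forall>\<sigma>. (\<forall>e>0. \<exists>N. \<forall>i\<ge>N. \<forall>j\<ge>N. riemannian_dist A g (\<sigma> i) (\<sigma> j) < ennreal e)
        \<longrightarrow> convergent \<sigma>)"


section \<open>Extended real valued functions and quasi distances\<close>

definition edom :: "('m \<Rightarrow> ereal) \<Rightarrow> 'm set" where
  "edom f = {x. f x < \<infinity>}"

definition proper :: "('m \<Rightarrow> ereal) \<Rightarrow> bool" where
  "proper f \<longleftrightarrow> (\<forall>x. f x \<noteq> -\<infinity>) \<and> edom f \<noteq> {}"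

definition lower_semicontinuous :: "('m::topological_space \<Rightarrow> ereal) \<Rightarrow> bool" where
  "lower_semicontinuous f \<longleftrightarrow> (\<forall>x. \<forall>t < f x. eventually (\<lambda>y. t < f y) (nhds x))"

definition quasi_distance :: "('m \<Rightarrow> 'm \<Rightarrow> real) \<Rightarrow> bool" where
  "quasi_distance D \<longleftrightarrow>
     (\<forall>x y. 0 \<le> D x y) \<and>
     (\<forall>x y. (D x y = 0 \<and> D y x = 0) \<longleftrightarrow> x = y) \<and>
     (\<forall>x y z. D x z \<le> D x y + D y z)"

definition quasi_ball :: "('m \<Rightarrow> 'm \<Rightarrow> real) \<Rightarrow> 'm \<Rightarrow> real \<Rightarrow> 'm set" where
  "quasi_ball D x \<epsilon> = {y. D y x < \<epsilon>}"


section \<open>Subdifferentials and the Kurdyka-Lojasiewicz property\<close>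

text \<open>A vector \<open>v\<close> with \<open>g x v u = dh\<^sub>x u\<close> for all tangent \<open>u\<close> is the gradient of \<open>h\<close> at \<open>x\<close>.\<close>

definition is_gradient ::
    "('m, 'n::finite) chart set \<Rightarrow> ('m, 'n) metric \<Rightarrow> ('m \<Rightarrow> real) \<Rightarrow> 'm \<Rightarrow> ('m, 'n) tvec \<Rightarrow> bool"
  where
  "is_gradient A g h x v \<longleftrightarrow>
     v \<in> tangent_space A x \<and> (\<forall>u\<in>tangent_space A x. g x v u = differential A h x u)"

definition frechet_subdifferential ::
    "('m::topological_space, 'n::finite) chart set \<Rightarrow> ('m, 'n) metric \<Rightarrow> ('m \<Rightarrow> ereal) \<Rightarrow> 'm \<Rightarrow>
     ('m, 'n) tvec set" where
  "frechet_subdifferential A g f x =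
     (if x \<in> edom f
      then {v. \<exists>h. C1_manifold A h \<and> is_gradient A g h x v \<and>
              eventually (\<lambda>y. f x - ereal (h x) \<le> f y - ereal (h y)) (nhds x)}
      else {})"

definition subdifferential ::
    "('m::topological_space, 'n::finite) chart set \<Rightarrow> ('m, 'n) metric \<Rightarrow> ('m \<Rightarrow> ereal) \<Rightarrow> 'm \<Rightarrow>
     ('m, 'n) tvec set" where
  "subdifferential A g f x =
     {v \<in> tangent_space A x. \<exists>y w.
        (\<forall>n::nat. w n \<in> frechet_subdifferential A g f (y n)) \<and>
        limitin (tangent_bundle_topology A) (\<lambda>n. (y n, w n)) (x, v) sequentially \<and>
        (\<lambda>n. f (y n)) \<longlonglongrightarrow> f x}"

definition critical_point ::
    "('m::topological_space, 'n::finite) chart set \<Rightarrow> ('m, 'n) metric \<Rightarrow> ('m \<Rightarrow> ereal) \<Rightarrow> 'm \<Rightarrow> bool"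
  where
  "critical_point A g f x \<longleftrightarrow> tvec_zero \<in> subdifferential A g f x"

definition dist_zero_subdifferential ::
    "('m::topological_space, 'n::finite) chart set \<Rightarrow> ('m, 'n) metric \<Rightarrow> ('m \<Rightarrow> ereal) \<Rightarrow> 'm \<Rightarrow> ereal"
  where
  "dist_zero_subdifferential A g f x = (INF v\<in>subdifferential A g f x. ereal (tnorm g x v))"

text \<open>The property at \<open>xbar\<close> with the given neighbourhood \<open>U\<close>, bound \<open>\<eta>\<close> and function \<open>\<phi>\<close>;
  the latter is only looked at on \<open>[0, \<eta>)\<close>.\<close>

definition KL_property_with ::
    "('m::topological_space, 'n::finite) chart set \<Rightarrow> ('m, 'n) metric \<Rightarrow> ('m \<Rightarrow> ereal) \<Rightarrow> 'm \<Rightarrow>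
     'm set \<Rightarrow> ereal \<Rightarrow> (real \<Rightarrow> real) \<Rightarrow> bool" where
  "KL_property_with A g f xbar U \<eta> \<phi> \<longleftrightarrow>
     subdifferential A g f xbar \<noteq> {} \<and>
     0 < \<eta> \<and> xbar \<in> interior U \<and>
     continuous_on {s. 0 \<le> s \<and> ereal s < \<eta>} \<phi> \<and>
     concave_on {s. 0 \<le> s \<and> ereal s < \<eta>} \<phi> \<and>
     (\<forall>s. 0 \<le> s \<and> ereal s < \<eta> \<longrightarrow> 0 \<le> \<phi> s) \<and>
     \<phi> 0 = 0 \<and>
     \<phi> C1_differentiable_on {s. 0 < s \<and> ereal s < \<eta>} \<and>
     (\<forall>s. 0 < s \<and> ereal s < \<eta> \<longrightarrow> 0 < deriv \<phi> s) \<and>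
     (\<forall>x\<in>U. f xbar < f x \<and> f x < f xbar + \<eta> \<longrightarrow>
        1 \<le> ereal (deriv \<phi> (real_of_ereal (f x - f xbar))) * dist_zero_subdifferential A g f x)"

end

theory Submission
  imports Defs
begin

text \<open>
  Write \<open>d k = D (x (Suc k)) (x k)\<close> and \<open>u k = f (x k) - f xt\<close>. Descent makes \<open>f \<circ> x\<close> decreasing, and
  lower semicontinuity puts \<open>xt\<close> into the domain of \<open>f\<close>; by continuity on the domain, \<open>u\<close> tends to \<open>0\<close>
  along a subsequence approaching \<open>xt\<close>, hence altogether.

  The steps are summable by the usual Kurdyka-Lojasiewicz argument (\<open>summable_of_KL_descent\<close>). The
  desingularising function \<open>\<phi>\<close> turns the quadratic decrease \<open>a * (d k)\<^sup>2\<close> of \<open>u\<close> into a decrease of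
  \<open>\<phi> \<circ> u\<close> that is linear in the steps: the slope of \<open>\<phi>\<close> at \<open>u (Suc k)\<close> is at least
  \<open>1 / (b * d k)\<close>, by the bound on the subgradients. Iterates starting close enough to \<open>xt\<close> cannot
  leave the ball where this applies: by the triangle inequality, step \<open>k\<close> raises \<open>D (x k) xt\<close> by at
  most \<open>d k\<close>, and \<open>D (x k) xt\<close> is small infinitely often, as \<open>D\<close> is continuous in its first argument.
  Summability forces convergence by hypothesis, and the limit can only be the accumulation point.

  That \<open>xt\<close> is critical is a statement about the tangent bundle: the subgradients \<open>w k\<close> have Riemannian
  norms tending to \<open>0\<close>, their base points tend to \<open>xt\<close>, and the subdifferential has to be closed along
  such sequences. A fixed chart at \<open>xt\<close> reduces this to Euclidean space: the metric dominates the
  coordinate norm near \<open>xt\<close> (\<open>metric_dominates_coordinates\<close>), so the coordinates of \<open>w k\<close> tend to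
  \<open>0\<close>, and limiting subgradients can be tested in this one chart (\<open>subdifferential_chart_iff\<close>,
  \<open>subdifferential_closed\<close>).
\<close>

section \<open>Charts and tangent spaces\<close>

lemma chart_inv_chart:
  assumes "is_chart c" "x \<in> fst c"
  shows "chart_inv c (snd c x) = x"
  using assms homeomorphism_apply1 unfolding is_chart_def by blast

lemma continuous_on_chart: "is_chart c \<Longrightarrow> continuous_on (fst c) (snd c)"
  unfolding is_chart_def homeomorphism_def by blast

lemma continuous_on_chart_inv: "is_chart c \<Longrightarrow> continuous_on (chart_image c) (chart_inv c)"
  unfolding is_chart_def homeomorphism_def by blast

lemma open_fst_chart: "is_chart c \<Longrightarrow> open (fst c)"
  unfolding is_chart_def by blast

lemma tendsto_chart:
  assumes "is_chart c" "x \<in> fst c"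
  shows "(snd c \<longlongrightarrow> snd c x) (nhds x)"
proof -
  have "(snd c \<longlongrightarrow> snd c x) (at x within fst c)"
    using continuous_on_chart[OF assms(1)] assms(2) by (simp add: continuous_on_def)
  then have "(snd c \<longlongrightarrow> snd c x) (at x)"
    by (simp only: at_within_open[OF assms(2) open_fst_chart[OF assms(1)]])
  then show ?thesis by (simp only: tendsto_at_iff_tendsto_nhds)
qed

lemma open_chart_overlap:
  assumes "is_chart c" "open V"
  shows "open (snd c ` (fst c \<inter> V))"
proof -
  have h: "homeomorphism (fst c) (chart_image c) (snd c) (chart_inv c)" and o: "open (chart_image c)"
    using assms unfolding is_chart_def by auto
  have "openin (top_of_set (chart_image c)) (snd c ` (fst c \<inter> V))"
    by (rule homeomorphism_imp_open_map[OF h]) (use assms in \<open>auto simp: openin_open\<close>)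
  then show ?thesis using o by (simp add: openin_open_eq)
qed

lemma smooth_atlas_is_chart: "smooth_atlas A \<Longrightarrow> c \<in> charts_at A x \<Longrightarrow> is_chart c"
  unfolding smooth_atlas_def charts_at_def by blast

lemma smooth_atlas_C1:
  assumes "smooth_atlas A" "c \<in> A" "c' \<in> A"
  shows "Ck_on 1 (snd c ` (fst c \<inter> fst c')) (snd c' \<circ> chart_inv c)"
  using assms unfolding smooth_atlas_def smooth_on_def by blast

lemma transition_has_derivative:
  assumes "smooth_atlas A" "c \<in> charts_at A x" "c' \<in> charts_at A x"
  shows "((snd c' \<circ> chart_inv c) has_derivative transition_deriv x c c') (at (snd c x))"
proof -
  have "snd c x \<in> snd c ` (fst c \<inter> fst c')" using assms by (auto simp: charts_at_def)
  then have "(snd c' \<circ> chart_inv c) differentiable at (snd c x)"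
    using smooth_atlas_C1[OF assms(1), of c c'] assms by (auto simp: charts_at_def)
  then show ?thesis unfolding transition_deriv_def by (simp add: frechet_derivative_works)
qed

lemma linear_transition:
  assumes "smooth_atlas A" "c \<in> charts_at A x" "c' \<in> charts_at A x"
  shows "linear (transition_deriv x c c')"
  using transition_has_derivative[OF assms] has_derivative_linear by blast

text \<open>The chain rule for \<open>c'' \<circ> c\<^sup>-\<^sup>1 = (c'' \<circ> c'\<^sup>-\<^sup>1) \<circ> (c' \<circ> c\<^sup>-\<^sup>1)\<close>, an identity
  that holds near \<open>snd c x\<close> because \<open>c\<close> and \<open>c'\<close> overlap in an open set. It is what makes the
  tangent space at \<open>x\<close> isomorphic to \<open>real^'n\<close> through each chart.\<close>

lemma transition_cocycle:
  assumes "smooth_atlas A" "c \<in> charts_at A x" "c' \<in> charts_at A x" "c'' \<in> charts_at A x"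
  shows "transition_deriv x c' c'' (transition_deriv x c c' u) = transition_deriv x c c'' u"
proof -
  have ch: "is_chart c" "is_chart c'" "is_chart c''"
    using assms smooth_atlas_is_chart by blast+
  have xin: "x \<in> fst c" "x \<in> fst c'" "x \<in> fst c''" using assms by (auto simp: charts_at_def)
  have e: "(snd c' \<circ> chart_inv c) (snd c x) = snd c' x"
    by (simp add: chart_inv_chart ch xin)
  have d: "((snd c'' \<circ> chart_inv c') \<circ> (snd c' \<circ> chart_inv c) has_derivative
        transition_deriv x c' c'' \<circ> transition_deriv x c c') (at (snd c x))"
    by (rule diff_chain_at) (use transition_has_derivative[OF assms(1)] assms e in auto)
  have "((snd c'' \<circ> chart_inv c) has_derivative
        transition_deriv x c' c'' \<circ> transition_deriv x c c') (at (snd c x))"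
  proof (rule has_derivative_transform_within_open[OF d])
    show "open (snd c ` (fst c \<inter> fst c'))" by (simp add: ch open_chart_overlap open_fst_chart)
    show "snd c x \<in> snd c ` (fst c \<inter> fst c')" using xin by blast
  qed (auto simp: chart_inv_chart ch)
  from has_derivative_unique[OF this transition_has_derivative[OF assms(1,2,4)]]
  show ?thesis by (metis comp_apply)
qed

lemma tvec_of_in_tangent_space:
  assumes "smooth_atlas A" "c \<in> charts_at A x"
  shows "tvec_of A x c u \<in> tangent_space A x"
  using assms by (auto simp: tvec_of_def tangent_space_def transition_cocycle)

lemma tangent_space_transition:
  assumes "v \<in> tangent_space A x" "c \<in> charts_at A x" "c' \<in> charts_at A x"
  shows "v c' = transition_deriv x c c' (v c)"
  using assms unfolding tangent_space_def by blast

lemma tvec_of_coord: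
  assumes "v \<in> tangent_space A x" "c \<in> charts_at A x"
  shows "tvec_of A x c (v c) = v"
proof
  fix c'
  show "tvec_of A x c (v c) c' = v c'"
  proof (cases "c' \<in> charts_at A x")
    case True
    then show ?thesis using tangent_space_transition[OF assms True] by (simp add: tvec_of_def)
  next
    case False
    moreover from False have "v c' = 0" using assms(1) unfolding tangent_space_def by blast
    ultimately show ?thesis by (simp add: tvec_of_def)
  qed
qed

lemma tvec_of_add:
  assumes "smooth_atlas A" "c \<in> charts_at A x"
  shows "tvec_of A x c (u + u') = tvec_add (tvec_of A x c u) (tvec_of A x c u')"
  using linear_transition[OF assms] by (auto simp: tvec_of_def tvec_add_def linear_add)

lemma tvec_of_scale:
  assumes "smooth_atlas A" "c \<in> charts_at A x"
  shows "tvec_of A x c (r *\<^sub>R u) = tvec_scale r (tvec_of A x c u)"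
  using linear_transition[OF assms] by (auto simp: tvec_of_def tvec_scale_def linear_scale)

lemma tvec_of_self:
  assumes "smooth_atlas A" "c \<in> charts_at A x"
  shows "tvec_of A x c u c = u"
proof -
  have ch: "is_chart c" and xin: "x \<in> fst c"
    using assms smooth_atlas_is_chart[OF assms] by (auto simp: charts_at_def)
  have "((snd c \<circ> chart_inv c) has_derivative (\<lambda>u. u)) (at (snd c x))"
  proof (rule has_derivative_transform_within_open[OF has_derivative_ident])
    show "open (chart_image c)" using ch unfolding is_chart_def by blast
    show "snd c x \<in> chart_image c" using xin by blast
  qed (auto simp: chart_inv_chart ch)
  from has_derivative_unique[OF this transition_has_derivative[OF assms assms(2)]]
  show ?thesis using assms(2) by (metis tvec_of_def)
qed

lemma tvec_zero_in_tangent_space: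
  assumes "smooth_atlas A"
  shows "tvec_zero \<in> tangent_space A x"
  using linear_transition[OF assms, of _ x] by (auto simp: tangent_space_def tvec_zero_def linear_0)


section \<open>The tangent bundle and closedness of the subdifferential\<close>

lemma limitin_topology_generated_by:
  assumes "l \<in> \<Union>S" and "\<And>V. V \<in> S \<Longrightarrow> l \<in> V \<Longrightarrow> eventually (\<lambda>i. s i \<in> V) F"
  shows "limitin (topology_generated_by S) s l F"
proof -
  have "l \<in> V \<longrightarrow> eventually (\<lambda>i. s i \<in> V) F" if "generate_topology_on S V" for V
    using that
  proof induction
    case (UN K)
    show ?case
    proof
      assume "l \<in> \<Union>K"
      then obtain X where X: "X \<in> K" "l \<in> X" by blast
      with UN.IH have "\<forall>\<^sub>F i in F. s i \<in> X" by blast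
      then show "\<forall>\<^sub>F i in F. s i \<in> \<Union>K" using X(1) by (auto elim: eventually_mono)
    qed
  qed (use assms(2) in \<open>auto intro: eventually_conj\<close>)
  then show ?thesis using assms(1)
    by (simp add: limitin_def openin_topology_generated_by_iff topology_generated_by_topspace)
qed

lemma limitin_tangent_bundle_coords:
  assumes "limitin (tangent_bundle_topology A) (\<lambda>i. (y i, w i)) (x, v) F"
    and "v \<in> tangent_space A x" "c \<in> charts_at A x"
  shows "\<forall>\<^sub>F i in F. y i \<in> fst c" and "((\<lambda>i. (snd c (y i), w i c)) \<longlongrightarrow> (snd c x, v c)) F"
proof -
  have *: "\<forall>\<^sub>F i in F. y i \<in> fst c \<and> (snd c (y i), w i c) \<in> W"
    if W: "open W" "(snd c x, v c) \<in> W" for W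
  proof -
    let ?V = "{(x, v) \<in> tangent_bundle A. x \<in> fst c \<and> (snd c x, v c) \<in> W}"
    have "openin (tangent_bundle_topology A) ?V"
      unfolding tangent_bundle_topology_def openin_topology_generated_by_iff
      by (rule generate_topology_on.Basis) (use W assms(3) in \<open>unfold charts_at_def, blast\<close>)
    moreover have "(x, v) \<in> ?V" using W assms by (auto simp: charts_at_def tangent_bundle_def)
    ultimately have "\<forall>\<^sub>F i in F. (y i, w i) \<in> ?V" using assms(1) by (simp only: limitin_def)
    then show ?thesis by eventually_elim auto
  qed
  show "\<forall>\<^sub>F i in F. y i \<in> fst c" using *[of UNIV] by simp
  show "((\<lambda>i. (snd c (y i), w i c)) \<longlongrightarrow> (snd c x, v c)) F"
    by (rule topological_tendstoI) (use * in \<open>force elim: eventually_mono\<close>)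
qed

text \<open>Convergence in the tangent bundle may be checked in one chart \<open>c\<close> at the limit point. In any
  other chart \<open>c'\<close> the coordinates are \<open>w i c' = transition_deriv (y i) c c' (w i c)\<close>, and the matrix
  of this linear map depends continuously on the base point since transition maps are continuously
  differentiable.\<close>

lemma limitin_tangent_bundle_chart:
  fixes A :: "('m::{t2_space, second_countable_topology}, 'n::finite) chart set"
  assumes A: "smooth_atlas A" and c: "c \<in> charts_at A x" and v: "v \<in> tangent_space A x"
    and y: "\<And>i. y i \<in> fst c" and w: "\<And>i. w i \<in> tangent_space A (y i)"
    and lim: "((\<lambda>i. snd c (y i)) \<longlongrightarrow> snd c x) F" "((\<lambda>i. w i c) \<longlongrightarrow> v c) F"
  shows "limitin (tangent_bundle_topology A) (\<lambda>i. (y i, w i)) (x, v) F"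
  unfolding tangent_bundle_topology_def
proof (rule limitin_topology_generated_by)
  have cA: "c \<in> A" "x \<in> fst c" and ch: "is_chart c"
    using c smooth_atlas_is_chart[OF A c] by (auto simp: charts_at_def)
  then show "(x, v) \<in> \<Union> {{(x, v) \<in> tangent_bundle A. x \<in> fst c \<and> (snd c x, v c) \<in> W} |c W.
               c \<in> A \<and> open W}"
    using v by (intro UnionI[of "{(x, v) \<in> tangent_bundle A. x \<in> fst c \<and> (snd c x, v c) \<in> UNIV}"])
      (blast, simp add: tangent_bundle_def)
  have ylim: "(y \<longlongrightarrow> x) F"
  proof -
    have "((\<lambda>i. chart_inv c (snd c (y i))) \<longlongrightarrow> chart_inv c (snd c x)) F"
      by (rule continuous_on_tendsto_compose[OF continuous_on_chart_inv[OF ch] lim(1)])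
        (use y cA in auto)
    then show ?thesis by (simp add: chart_inv_chart ch cA y)
  qed
  fix V assume "V \<in> {{(x, v) \<in> tangent_bundle A. x \<in> fst c \<and> (snd c x, v c) \<in> W} |c W.
               c \<in> A \<and> open W}" and inV: "(x, v) \<in> V"
  then obtain c' W where V: "V = {(x, v) \<in> tangent_bundle A. x \<in> fst c' \<and> (snd c' x, v c') \<in> W}"
    and c'A: "c' \<in> A" and W: "open W" by blast
  have x': "x \<in> fst c'" "(snd c' x, v c') \<in> W" using inV V by auto
  have c': "c' \<in> charts_at A x" using c'A x' by (simp add: charts_at_def)
  note ch' = smooth_atlas_is_chart[OF A c']
  have ev: "\<forall>\<^sub>F i in F. y i \<in> fst c'"
    by (rule topological_tendstoD[OF ylim open_fst_chart[OF ch'] x'(1)])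
  have coord': "transition_deriv z c c' u = (\<Sum>b\<in>Basis. (u \<bullet> b) *\<^sub>R transition_deriv z c c' b)"
    if "z \<in> fst c" "z \<in> fst c'" for z u
  proof -
    have l: "linear (transition_deriv z c c')"
      by (rule linear_transition[OF A]) (use that cA c'A in \<open>auto simp: charts_at_def\<close>)
    have "transition_deriv z c c' u = transition_deriv z c c' (\<Sum>b\<in>Basis. (u \<bullet> b) *\<^sub>R b)"
      by (simp add: euclidean_representation)
    also have "\<dots> = (\<Sum>b\<in>Basis. (u \<bullet> b) *\<^sub>R transition_deriv z c c' b)"
      by (simp add: linear_sum[OF l] linear_scale[OF l])
    finally show ?thesis .
  qed
  have dlim: "((\<lambda>i. transition_deriv (y i) c c' b) \<longlongrightarrow> transition_deriv x c c' b) F" for b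
  proof -
    have "continuous_on (snd c ` (fst c \<inter> fst c'))
            (\<lambda>p. frechet_derivative (snd c' \<circ> chart_inv c) (at p) b)"
      using smooth_atlas_C1[OF A cA(1) c'A] by simp
    moreover have "\<forall>\<^sub>F i in F. snd c (y i) \<in> snd c ` (fst c \<inter> fst c')"
      using ev by eventually_elim (use y in blast)
    moreover have "snd c x \<in> snd c ` (fst c \<inter> fst c')" using cA x' by blast
    ultimately show ?thesis
      unfolding transition_deriv_def by (intro continuous_on_tendsto_compose[OF _ lim(1)])
  qed
  have "((\<lambda>i. \<Sum>b\<in>Basis. (w i c \<bullet> b) *\<^sub>R transition_deriv (y i) c c' b)
          \<longlongrightarrow> (\<Sum>b\<in>Basis. (v c \<bullet> b) *\<^sub>R transition_deriv x c c' b)) F"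
    by (intro tendsto_intros dlim lim)
  also have "(\<Sum>b\<in>Basis. (v c \<bullet> b) *\<^sub>R transition_deriv x c c' b) = v c'"
    by (rule trans[OF tangent_space_transition[OF v c c'] coord'[OF cA(2) x'(1)], symmetric])
  finally have "((\<lambda>i. w i c') \<longlongrightarrow> v c') F"
  proof (rule Lim_transform_eventually)
    show "\<forall>\<^sub>F i in F. (\<Sum>b\<in>Basis. (w i c \<bullet> b) *\<^sub>R transition_deriv (y i) c c' b) = w i c'"
      using ev
    proof eventually_elim
      case (elim i)
      have "c \<in> charts_at A (y i)" "c' \<in> charts_at A (y i)"
        using elim y cA c'A by (auto simp: charts_at_def)
      then show ?case
        by (rule trans[OF tangent_space_transition[OF w] coord'[OF y elim], symmetric])
    qed
  qed
  moreover have "((\<lambda>i. snd c' (y i)) \<longlongrightarrow> snd c' x) F"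
    by (rule filterlim_compose[OF tendsto_chart[OF ch' x'(1)] ylim])
  ultimately have "((\<lambda>i. (snd c' (y i), w i c')) \<longlongrightarrow> (snd c' x, v c')) F"
    by (intro tendsto_Pair)
  from topological_tendstoD[OF this W x'(2)] ev
  show "\<forall>\<^sub>F i in F. (y i, w i) \<in> V"
    by eventually_elim (simp add: V tangent_bundle_def w)
qed

text \<open>In coordinates, limiting subgradients are the cluster points of triples (point, Frechet
  subgradient, value). This replaces the sequences of the definition by neighbourhoods, so that
  closedness below needs no diagonal sequence; \<open>ereal\<close> is first countable, which gives the sequences
  back.\<close>

lemma subdifferential_chart_iff:
  fixes A :: "('m::{t2_space, second_countable_topology}, 'n::finite) chart set"
  assumes A: "smooth_atlas A" and c: "c \<in> charts_at A x" and v: "v \<in> tangent_space A x"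
  shows "v \<in> subdifferential A g f x \<longleftrightarrow>
    (\<forall>N. open N \<and> (snd c x, v c, f x) \<in> N \<longrightarrow>
       (\<exists>y\<in>fst c. \<exists>w\<in>frechet_subdifferential A g f y. (snd c y, w c, f y) \<in> N))"
    (is "?L \<longleftrightarrow> ?R")
proof
  assume ?L
  then obtain y w where yw: "\<And>n::nat. w n \<in> frechet_subdifferential A g f (y n)"
    and lim: "limitin (tangent_bundle_topology A) (\<lambda>n. (y n, w n)) (x, v) sequentially"
    and flim: "(\<lambda>n. f (y n)) \<longlonglongrightarrow> f x"
    unfolding subdifferential_def by blast
  have "(\<lambda>n. (fst (snd c (y n), w n c), snd (snd c (y n), w n c), f (y n)))
          \<longlonglongrightarrow> (fst (snd c x, v c), snd (snd c x, v c), f x)"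
    by (intro tendsto_Pair tendsto_fst tendsto_snd flim limitin_tangent_bundle_coords(2)[OF lim v c])
  then have t: "(\<lambda>n. (snd c (y n), w n c, f (y n))) \<longlonglongrightarrow> (snd c x, v c, f x)" by simp
  show ?R
  proof (intro allI impI)
    fix N assume "open N \<and> (snd c x, v c, f x) \<in> N"
    with t have "\<forall>\<^sub>F n in sequentially. (snd c (y n), w n c, f (y n)) \<in> N"
      by (simp add: tendsto_def)
    with limitin_tangent_bundle_coords(1)[OF lim v c]
    have "\<forall>\<^sub>F n in sequentially. y n \<in> fst c \<and> (snd c (y n), w n c, f (y n)) \<in> N"
      by (rule eventually_conj)
    then obtain n where "y n \<in> fst c" "(snd c (y n), w n c, f (y n)) \<in> N"
      by (auto simp: eventually_sequentially)
    with yw[of n]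
    show "\<exists>y\<in>fst c. \<exists>w\<in>frechet_subdifferential A g f y. (snd c y, w c, f y) \<in> N" by blast
  qed
next
  assume R: ?R
  obtain N where N: "\<And>n::nat. open (N n)" "\<And>n. (snd c x, v c, f x) \<in> N n"
    "\<And>s. (\<And>n. s n \<in> N n) \<Longrightarrow> s \<longlonglongrightarrow> (snd c x, v c, f x)"
    using first_countable_topology_class.countable_basis[of "(snd c x, v c, f x)"] by metis
  have "\<exists>y w. y \<in> fst c \<and> w \<in> frechet_subdifferential A g f y \<and> (snd c y, w c, f y) \<in> N n" for n
    using R[rule_format, OF conjI, OF N(1,2)] by blast
  then have "\<forall>n. \<exists>p. fst p \<in> fst c \<and> snd p \<in> frechet_subdifferential A g f (fst p) \<and>
      (snd c (fst p), snd p c, f (fst p)) \<in> N n" by (metis fst_conv snd_conv)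
  then obtain p where p: "\<forall>n. fst (p n) \<in> fst c \<and> snd (p n) \<in> frechet_subdifferential A g f (fst (p n)) \<and>
      (snd c (fst (p n)), snd (p n) c, f (fst (p n))) \<in> N n"
    unfolding choice_iff by blast
  define y w where "y n = fst (p n)" and "w n = snd (p n)" for n
  with p have yw: "\<And>n. y n \<in> fst c" "\<And>n. w n \<in> frechet_subdifferential A g f (y n)"
    "\<And>n. (snd c (y n), w n c, f (y n)) \<in> N n" by auto
  have t: "(\<lambda>n. (snd c (y n), w n c, f (y n))) \<longlonglongrightarrow> (snd c x, v c, f x)"
    by (rule N(3)) (rule yw(3))
  have wT: "w n \<in> tangent_space A (y n)" for n
    using yw(2)[of n] by (auto simp: frechet_subdifferential_def is_gradient_def split: if_splits)
  have "limitin (tangent_bundle_topology A) (\<lambda>n. (y n, w n)) (x, v) sequentially"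
    by (rule limitin_tangent_bundle_chart[OF A c v yw(1) wT])
      (use tendsto_fst[OF t] tendsto_fst[OF tendsto_snd[OF t]] in auto)
  moreover have "(\<lambda>n. f (y n)) \<longlonglongrightarrow> f x" using tendsto_snd[OF tendsto_snd[OF t]] by simp
  ultimately show ?L unfolding subdifferential_def using v yw(2) by blast
qed

text \<open>A neighbourhood of the limit triple is also a neighbourhood of some triple
  \<open>(y n, w n, f (y n))\<close>, hence meets the graph of the Frechet subdifferential.\<close>

lemma subdifferential_closed:
  fixes A :: "('m::{t2_space, second_countable_topology}, 'n::finite) chart set"
  assumes A: "smooth_atlas A" and c: "c \<in> charts_at A x" and v: "v \<in> tangent_space A x"
    and w: "\<And>n. w n \<in> subdifferential A g f (y n)"
    and y: "y \<longlonglongrightarrow> x" and wlim: "(\<lambda>n. w n c) \<longlonglongrightarrow> v c" and flim: "(\<lambda>n. f (y n)) \<longlonglongrightarrow> f x"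
  shows "v \<in> subdifferential A g f x"
  unfolding subdifferential_chart_iff[OF A c v]
proof (intro allI impI)
  have ch: "is_chart c" and cA: "c \<in> A" "x \<in> fst c"
    using c smooth_atlas_is_chart[OF A c] by (auto simp: charts_at_def)
  fix N assume N: "open N \<and> (snd c x, v c, f x) \<in> N"
  have "(\<lambda>n. (snd c (y n), w n c, f (y n))) \<longlonglongrightarrow> (snd c x, v c, f x)"
    by (intro tendsto_Pair wlim flim filterlim_compose[OF tendsto_chart[OF ch cA(2)] y])
  with N have "\<forall>\<^sub>F n in sequentially. (snd c (y n), w n c, f (y n)) \<in> N"
    by (simp add: tendsto_def)
  then have "\<forall>\<^sub>F n in sequentially. (snd c (y n), w n c, f (y n)) \<in> N \<and> y n \<in> fst c"
    using topological_tendstoD[OF y open_fst_chart[OF ch] cA(2)] by (rule eventually_conj)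
  then obtain n where n: "(snd c (y n), w n c, f (y n)) \<in> N" "y n \<in> fst c"
    by (auto simp: eventually_sequentially)
  have "c \<in> charts_at A (y n)" using n cA by (simp add: charts_at_def)
  moreover have "w n \<in> tangent_space A (y n)"
    using w[of n] by (simp add: subdifferential_def)
  ultimately
  have "\<forall>N. open N \<and> (snd c (y n), w n c, f (y n)) \<in> N \<longrightarrow>
      (\<exists>y\<in>fst c. \<exists>w\<in>frechet_subdifferential A g f y. (snd c y, w c, f y) \<in> N)"
    by (rule subdifferential_chart_iff[THEN iffD1, OF A _ _ w])
  from mp[OF spec[OF this, of N] conjI[OF conjunct1[OF N] n(1)]]
  show "\<exists>y\<in>fst c. \<exists>w\<in>frechet_subdifferential A g f y. (snd c y, w c, f y) \<in> N" .
qed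


section \<open>The Riemannian metric in coordinates\<close>

text \<open>The constant is the minimum of the quadratic form on the unit sphere; homogeneity does the
  rest.\<close>

lemma bilinear_positive_definite_coercive:
  fixes h :: "'a::euclidean_space \<Rightarrow> 'a \<Rightarrow> real"
  assumes h: "bilinear h" and pos: "\<And>u. u \<noteq> 0 \<Longrightarrow> 0 < h u u"
  obtains \<kappa> where "\<kappa> > 0" "\<And>u. \<kappa> * (norm u)\<^sup>2 \<le> h u u"
proof -
  have cont: "continuous_on (sphere 0 1) (\<lambda>u. h u u)"
    by (intro bilinear_continuous_on_compose[OF _ _ h] continuous_intros)
  obtain e :: 'a where "e \<in> sphere 0 1"
    using vector_choose_size[of 1] by auto
  then obtain m where m: "norm m = 1" and min: "\<And>u. norm u = 1 \<Longrightarrow> h m m \<le> h u u"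
    using continuous_attains_inf[OF compact_sphere _ cont] by (force simp: dist_norm)
  have "h m m * (norm u)\<^sup>2 \<le> h u u" for u
  proof (cases "u = 0")
    case True
    then show ?thesis using bilinear_lzero[OF h] by simp
  next
    case False
    let ?u = "(1 / norm u) *\<^sub>R u"
    have "h m m \<le> h ?u ?u" by (rule min) (use False in simp)
    also have "\<dots> = h u u / (norm u)\<^sup>2"
      by (simp add: bilinear_lmul[OF h] bilinear_rmul[OF h] power2_eq_square)
    finally show ?thesis using False by (simp add: field_simps)
  qed
  moreover have "0 < h m m" by (rule pos) (use m in auto)
  ultimately show ?thesis using that by blast
qed

lemma bilinear_metric_coords:
  assumes A: "smooth_atlas A" and g: "riemannian_metric A g" and c: "c \<in> charts_at A x"
  shows "bilinear (\<lambda>u u'. g x (tvec_of A x c u) (tvec_of A x c u'))"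
proof -
  note T = tvec_of_in_tangent_space[OF A c]
  have l: "linear (\<lambda>u. g x (tvec_of A x c u) (tvec_of A x c u'))" for u'
    using g T by (auto intro!: linearI simp: riemannian_metric_def tvec_of_add[OF A c] tvec_of_scale[OF A c])
  have s: "g x (tvec_of A x c u) (tvec_of A x c u') = g x (tvec_of A x c u') (tvec_of A x c u)" for u u'
    using g T unfolding riemannian_metric_def by blast
  have "linear (\<lambda>u'. g x (tvec_of A x c u) (tvec_of A x c u'))" for u
    by (subst s) (rule l)
  with l show ?thesis unfolding bilinear_def by blast
qed

lemma metric_coords_tendsto:
  fixes A :: "('m::{t2_space, second_countable_topology}, 'n::finite) chart set"
  assumes A: "smooth_atlas A" and g: "riemannian_metric A g" and c: "c \<in> charts_at A x"
  shows "((\<lambda>y. g y (tvec_of A y c u) (tvec_of A y c u')) \<longlongrightarrow> g x (tvec_of A x c u) (tvec_of A x c u')) (nhds x)"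
proof -
  have ch: "is_chart c" and cA: "c \<in> A" "x \<in> fst c"
    using c smooth_atlas_is_chart[OF A c] by (auto simp: charts_at_def)
  define G where "G p = g (chart_inv c p) (tvec_of A (chart_inv c p) c u) (tvec_of A (chart_inv c p) c u')" for p
  have "smooth_on (chart_image c) G"
    using g cA unfolding riemannian_metric_def G_def Let_def by blast
  then have "Ck_on 0 (chart_image c) G" unfolding smooth_on_def by blast
  then have G: "continuous_on (chart_image c) G" by simp
  have near: "\<forall>\<^sub>F y in nhds x. y \<in> fst c"
    using cA open_fst_chart[OF ch] eventually_nhds_in_open by blast
  have "((\<lambda>y. G (snd c y)) \<longlongrightarrow> G (snd c x)) (nhds x)"
    by (rule continuous_on_tendsto_compose[OF G tendsto_chart[OF ch cA(2)]])
      (use cA near in \<open>auto elim: eventually_mono\<close>)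
  moreover have "\<forall>\<^sub>F y in nhds x. G (snd c y) = g y (tvec_of A y c u) (tvec_of A y c u')"
    using near by eventually_elim (simp add: G_def chart_inv_chart[OF ch])
  ultimately show ?thesis
    using Lim_transform_eventually chart_inv_chart[OF ch cA(2)] unfolding G_def by fastforce
qed

text \<open>At \<open>x\<close> itself this is coercivity of a positive definite form. The matrix entries of the metric
  are continuous, so near \<open>x\<close> the quadratic form changes by at most half of the coercivity constant
  times the squared norm.\<close>

lemma metric_dominates_coordinates:
  fixes A :: "('m::{t2_space, second_countable_topology}, 'n::finite) chart set"
  assumes A: "smooth_atlas A" and g: "riemannian_metric A g" and c: "c \<in> charts_at A x"
  obtains \<kappa> where "\<kappa> > 0"
    "\<forall>\<^sub>F y in nhds x. \<forall>v\<in>tangent_space A y. \<kappa> * (norm (v c))\<^sup>2 \<le> g y v v"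
proof -
  have ch: "is_chart c" and cA: "c \<in> A" "x \<in> fst c"
    using c smooth_atlas_is_chart[OF A c] by (auto simp: charts_at_def)
  define h where "h y u u' = g y (tvec_of A y c u) (tvec_of A y c u')" for y u u'
  have bil: "bilinear (h y)" if "y \<in> fst c" for y
    unfolding h_def[abs_def]
    by (rule bilinear_metric_coords[OF A g]) (use that cA in \<open>simp add: charts_at_def\<close>)
  have pos: "0 < h x u u" if "u \<noteq> 0" for u
  proof -
    have "tvec_of A x c u \<noteq> tvec_zero"
      using tvec_of_self[OF A c, of u] that by (auto simp: tvec_zero_def)
    then show ?thesis using g tvec_of_in_tangent_space[OF A c]
      unfolding h_def riemannian_metric_def by blast
  qed
  obtain \<kappa> where \<kappa>: "\<kappa> > 0" "\<And>u. \<kappa> * (norm u)\<^sup>2 \<le> h x u u"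
    using bilinear_positive_definite_coercive[OF bil[OF cA(2)] pos] by blast
  define \<delta> where "\<delta> y = (\<Sum>(i,j)\<in>Basis\<times>Basis. \<bar>h y i j - h x i j\<bar>)" for y
  have "(\<delta> \<longlongrightarrow> (\<Sum>(i,j)\<in>(Basis::(real^'n) set)\<times>(Basis::(real^'n) set). \<bar>h x i j - h x i j\<bar>)) (nhds x)"
    unfolding \<delta>_def[abs_def] split_def
    by (intro tendsto_sum tendsto_rabs tendsto_diff tendsto_const)
      (simp add: h_def metric_coords_tendsto[OF A g c])
  then have "(\<delta> \<longlongrightarrow> 0) (nhds x)" by simp
  then have "\<forall>\<^sub>F y in nhds x. \<delta> y < \<kappa> / 2" using \<kappa>(1) by (intro order_tendstoD) auto
  moreover have "\<forall>\<^sub>F y in nhds x. y \<in> fst c"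
    using cA open_fst_chart[OF ch] eventually_nhds_in_open by blast
  ultimately have "\<forall>\<^sub>F y in nhds x. \<forall>v\<in>tangent_space A y. \<kappa> / 2 * (norm (v c))\<^sup>2 \<le> g y v v"
  proof eventually_elim
    case (elim y)
    show ?case
    proof
      fix v assume v: "v \<in> tangent_space A y"
      define u where "u = v c"
      have expand: "h z u u = (\<Sum>(i,j)\<in>Basis\<times>Basis. (u \<bullet> i) * (u \<bullet> j) * h z i j)"
        if "z \<in> fst c" for z
      proof -
        note b = bil[OF that]
        have "h z u u = h z (\<Sum>i\<in>Basis. (u \<bullet> i) *\<^sub>R i) (\<Sum>j\<in>Basis. (u \<bullet> j) *\<^sub>R j)"
          by (simp add: euclidean_representation)
        then show ?thesis
          by (simp add: bilinear_sum[OF b] bilinear_lmul[OF b] bilinear_rmul[OF b] mult_ac)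
      qed
      have "\<bar>h y u u - h x u u\<bar>
          = \<bar>\<Sum>(i,j)\<in>Basis\<times>Basis. (u \<bullet> i) * (u \<bullet> j) * (h y i j - h x i j)\<bar>"
        unfolding expand[OF elim(2)] expand[OF cA(2)] sum_subtractf[symmetric]
        by (simp add: split_def right_diff_distrib)
      also have "\<dots> \<le> (\<Sum>(i,j)\<in>Basis\<times>Basis. (norm u)\<^sup>2 * \<bar>h y i j - h x i j\<bar>)"
      proof (rule order_trans[OF sum_abs], rule sum_mono)
        fix p :: "(real^'n) \<times> (real^'n)" assume "p \<in> Basis \<times> Basis"
        then obtain i j where p: "p = (i, j)" "i \<in> Basis" "j \<in> Basis" by auto
        have "\<bar>u \<bullet> i\<bar> * \<bar>u \<bullet> j\<bar> \<le> norm u * norm u"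
          using p by (intro mult_mono) (auto simp: Basis_le_norm)
        then show "\<bar>case p of (i,j) \<Rightarrow> (u \<bullet> i) * (u \<bullet> j) * (h y i j - h x i j)\<bar>
            \<le> (case p of (i,j) \<Rightarrow> (norm u)\<^sup>2 * \<bar>h y i j - h x i j\<bar>)"
          by (simp add: p abs_mult power2_eq_square mult_right_mono)
      qed
      also have "\<dots> = (norm u)\<^sup>2 * \<delta> y" by (simp add: \<delta>_def sum_distrib_left split_def)
      also have "\<dots> \<le> (norm u)\<^sup>2 * (\<kappa> / 2)" using elim(1) by (intro mult_left_mono) auto
      finally have "\<bar>h y u u - h x u u\<bar> \<le> (norm u)\<^sup>2 * (\<kappa> / 2)" .
      then have "h x u u - h y u u \<le> \<kappa> / 2 * (norm u)\<^sup>2"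
        unfolding abs_le_iff by (simp add: mult_ac)
      then have "\<kappa> / 2 * (norm u)\<^sup>2 \<le> h y u u" using \<kappa>(2)[of u] by simp
      moreover have "tvec_of A y c (v c) = v"
        by (rule tvec_of_coord[OF v]) (use elim cA in \<open>simp add: charts_at_def\<close>)
      ultimately show "\<kappa> / 2 * (norm (v c))\<^sup>2 \<le> g y v v" by (simp add: h_def u_def)
    qed
  qed
  with \<kappa>(1) show ?thesis using that[of "\<kappa> / 2"] by simp
qed

lemma tnorm_tendsto_zero_coords:
  fixes A :: "('m::{t2_space, second_countable_topology}, 'n::finite) chart set"
  assumes A: "smooth_atlas A" and g: "riemannian_metric A g" and c: "c \<in> charts_at A x"
    and y: "(y \<longlongrightarrow> x) F" and w: "\<And>i. w i \<in> tangent_space A (y i)"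
    and lim: "((\<lambda>i. tnorm g (y i) (w i)) \<longlongrightarrow> 0) F"
  shows "((\<lambda>i. w i c) \<longlongrightarrow> 0) F"
proof -
  obtain \<kappa> where \<kappa>: "\<kappa> > 0"
    and dom: "\<forall>\<^sub>F z in nhds x. \<forall>v\<in>tangent_space A z. \<kappa> * (norm (v c))\<^sup>2 \<le> g z v v"
    using metric_dominates_coordinates[OF A g c] by blast
  have "\<forall>\<^sub>F i in F. norm (w i c) \<le> tnorm g (y i) (w i) / sqrt \<kappa>"
    using filterlim_iff[THEN iffD1, OF y, rule_format, OF dom]
  proof eventually_elim
    case (elim i)
    then have "\<kappa> * (norm (w i c))\<^sup>2 \<le> g (y i) (w i) (w i)" using w by blast
    then have "sqrt (\<kappa> * (norm (w i c))\<^sup>2) \<le> tnorm g (y i) (w i)"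
      unfolding tnorm_def by (rule real_sqrt_le_mono)
    then show ?case using \<kappa> by (simp add: real_sqrt_mult field_simps)
  qed
  moreover have "((\<lambda>i. tnorm g (y i) (w i) / sqrt \<kappa>) \<longlongrightarrow> 0) F"
    using tendsto_divide[OF lim tendsto_const, of "sqrt \<kappa>"] \<kappa> by simp
  ultimately show ?thesis by (rule Lim_null_comparison)
qed

lemma tnorm_nonneg:
  assumes A: "smooth_atlas A" and g: "riemannian_metric A g" and v: "v \<in> tangent_space A x"
  shows "0 \<le> tnorm g x v"
proof (cases "v = tvec_zero")
  case True
  have "tvec_scale 0 tvec_zero = (tvec_zero :: ('a, 'b) tvec)"
    by (simp add: tvec_scale_def tvec_zero_def)
  then have "g x tvec_zero tvec_zero = 0 * g x tvec_zero tvec_zero"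
    using g tvec_zero_in_tangent_space[OF A, of x] unfolding riemannian_metric_def by metis
  then show ?thesis by (simp add: tnorm_def True)
next
  case False
  then have "0 < g x v v" using g v unfolding riemannian_metric_def by blast
  then show ?thesis by (simp add: tnorm_def)
qed


section \<open>Summability of the steps\<close>

text \<open>The graph of a concave function lies below its tangent at \<open>s\<close>.\<close>

lemma concave_tangent_bound:
  fixes \<phi> :: "real \<Rightarrow> real"
  assumes conc: "concave_on {s. 0 \<le> s \<and> ereal s < \<eta>} \<phi>"
    and C1: "\<phi> C1_differentiable_on {s. 0 < s \<and> ereal s < \<eta>}"
    and s: "0 < s" "ereal s < \<eta>" and t: "0 \<le> t" "t \<le> s"
  shows "deriv \<phi> s * (s - t) \<le> \<phi> s - \<phi> t"
proof -
  obtain \<phi>' where \<phi>': "(\<phi> has_vector_derivative \<phi>') (at s)"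
    using C1 s unfolding C1_differentiable_on_def by blast
  then have d: "(\<phi> has_real_derivative \<phi>') (at s)"
    by (simp add: has_real_derivative_iff_has_vector_derivative)
  have tb: "(- \<phi> t) - (- \<phi> s) \<ge> (- \<phi>') * (t - s)"
  proof (rule convex_on_imp_above_tangent)
    show "convex_on {s. 0 \<le> s \<and> ereal s < \<eta>} (\<lambda>x. - \<phi> x)" using conc by (simp add: concave_on_def)
    then have "convex {s. 0 \<le> s \<and> ereal s < \<eta>}" by (rule convex_on_imp_convex)
    then show "connected {s. 0 \<le> s \<and> ereal s < \<eta>}" by (rule convex_connected)
    have "open {s. 0 < s \<and> ereal s < \<eta>}"
      by (intro open_Collect_conj open_Collect_less continuous_intros)
    then show "s \<in> interior {s. 0 \<le> s \<and> ereal s < \<eta>}"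
      by (rule interiorI) (use s in auto)
    show "t \<in> {s. 0 \<le> s \<and> ereal s < \<eta>}"
      using t le_less_trans[of "ereal t" "ereal s" \<eta>] s(2) by simp
    show "((\<lambda>x. - \<phi> x) has_real_derivative - \<phi>') (at s within {s. 0 \<le> s \<and> ereal s < \<eta>})"
      by (rule has_field_derivative_at_within[OF DERIV_minus[OF d]])
  qed
  then show ?thesis by (simp add: DERIV_imp_deriv[OF d] algebra_simps)
qed

text \<open>The finite length argument, stripped of all geometry: \<open>d k\<close> is the length of the \<open>k\<close>-th step,
  \<open>e k\<close> the distance from the \<open>k\<close>-th iterate to the limit point, \<open>u k\<close> the gap in objective value.
  Inside the trap \<open>e < \<rho>\<close> the Kurdyka-Lojasiewicz inequality, concavity of \<open>\<phi>\<close> and sufficient descent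
  combine to \<open>(d (Suc k))\<^sup>2 \<le> d k * C * \<Delta>\<close>, where \<open>\<Delta>\<close> is the decrease of \<open>\<phi> \<circ> u\<close> in that step and
  \<open>C = b / a\<close>. By the arithmetic-geometric mean inequality \<open>2 * d (Suc k) \<le> d k + C * \<Delta>\<close>, which
  telescopes to a bound on the sum of the steps. The bound tends to zero with the starting index, so a
  start close to the limit point with a small bound never leaves the trap.\<close>

lemma summable_of_KL_descent:
  fixes d e u :: "nat \<Rightarrow> real" and \<phi> :: "real \<Rightarrow> real" and \<eta> :: ereal
  assumes "a > 0" "b > 0" "\<rho> > 0" "\<eta> > 0"
    and d: "\<And>k. 0 \<le> d k" and e: "\<And>k. e (Suc k) \<le> d k + e k"
    and small: "\<And>\<epsilon>. \<epsilon> > 0 \<Longrightarrow> \<exists>\<^sub>F k in sequentially. e k < \<epsilon>"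
    and u: "\<And>k. 0 < u k" "u \<longlonglongrightarrow> 0"
    and descent: "\<And>k. a * (d k)\<^sup>2 \<le> u k - u (Suc k)"
    and \<phi>: "continuous_on {s. 0 \<le> s \<and> ereal s < \<eta>} \<phi>" "\<phi> 0 = 0"
      "\<And>s. 0 \<le> s \<Longrightarrow> ereal s < \<eta> \<Longrightarrow> 0 \<le> \<phi> s"
    and tangent: "\<And>s t. 0 < s \<Longrightarrow> ereal s < \<eta> \<Longrightarrow> 0 \<le> t \<Longrightarrow> t \<le> s \<Longrightarrow> \<phi>' s * (s - t) \<le> \<phi> s - \<phi> t"
    and KL: "\<And>k. e (Suc k) < \<rho> \<Longrightarrow> ereal (u (Suc k)) < \<eta> \<Longrightarrow> 1 \<le> \<phi>' (u (Suc k)) * (b * d k)"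
  shows "summable d"
proof -
  define C where "C = b / a"
  have C: "C > 0" using assms by (simp add: C_def)
  have "decseq u"
  proof (rule decseq_SucI)
    show "u (Suc k) \<le> u k" for k
    proof -
      have "0 \<le> a * (d k)\<^sup>2" using \<open>a > 0\<close> by simp
      with descent[of k] show ?thesis by linarith
    qed
  qed
  have "(\<lambda>k. ereal (u k)) \<longlonglongrightarrow> ereal 0" using u(2) by simp
  then have evu: "\<forall>\<^sub>F k in sequentially. ereal (u k) < \<eta>"
    using \<open>\<eta> > 0\<close> by (intro order_tendstoD) (auto simp: zero_ereal_def)
  have "d \<longlonglongrightarrow> 0"
  proof -
    have "(\<lambda>k. (u k - u (Suc k)) / a) \<longlonglongrightarrow> (0 - 0) / a"
      by (intro tendsto_intros u(2) LIMSEQ_Suc) (use \<open>a > 0\<close> in simp)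
    then have quot: "(\<lambda>k. (u k - u (Suc k)) / a) \<longlonglongrightarrow> 0" by simp
    have "\<forall>\<^sub>F k in sequentially. norm ((d k)\<^sup>2) \<le> (u k - u (Suc k)) / a"
      using descent \<open>a > 0\<close> by (intro always_eventually) (simp add: field_simps)
    from this quot have "(\<lambda>k. (d k)\<^sup>2) \<longlonglongrightarrow> 0" by (rule Lim_null_comparison)
    then have "(\<lambda>k. sqrt ((d k)\<^sup>2)) \<longlonglongrightarrow> sqrt 0" by (rule tendsto_real_sqrt)
    then show ?thesis using d by simp
  qed
  have philim: "(\<lambda>k. \<phi> (u k)) \<longlonglongrightarrow> 0"
  proof -
    have "(\<lambda>k. \<phi> (u k)) \<longlonglongrightarrow> \<phi> 0"
      by (rule continuous_on_tendsto_compose[OF \<phi>(1) u(2)])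
        (use \<open>\<eta> > 0\<close> evu u(1) in \<open>auto simp: zero_ereal_def less_imp_le elim: eventually_mono\<close>)
    then show ?thesis by (simp add: \<phi>(2))
  qed
  have "(\<lambda>k. d k + C * \<phi> (u (Suc k))) \<longlonglongrightarrow> 0 + C * 0"
    by (intro tendsto_intros \<open>d \<longlonglongrightarrow> 0\<close> LIMSEQ_Suc philim)
  then have "\<forall>\<^sub>F k in sequentially. d k + C * \<phi> (u (Suc k)) < \<rho> / 2"
    using \<open>\<rho> > 0\<close> by (intro order_tendstoD) auto
  with evu have "\<forall>\<^sub>F k in sequentially. ereal (u k) < \<eta> \<and> d k + C * \<phi> (u (Suc k)) < \<rho> / 2"
    by (rule eventually_conj)
  then obtain K where K: "\<And>k. k \<ge> K \<Longrightarrow> ereal (u k) < \<eta>"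
    "\<And>k. k \<ge> K \<Longrightarrow> d k + C * \<phi> (u (Suc k)) < \<rho> / 2"
    unfolding eventually_sequentially by blast
  \<comment> \<open>The trap radius is split evenly: one half for the distance of the starting iterate
    \<open>Suc m\<close>, one half for the sum of all later steps.\<close>
  obtain m' where "m' \<ge> Suc K" "e m' < \<rho> / 2"
    using small[of "\<rho> / 2"] \<open>\<rho> > 0\<close> unfolding frequently_sequentially by auto
  then obtain m where m: "m \<ge> K" "e (Suc m) < \<rho> / 2" by (cases m') auto
  have step: "2 * d (Suc k) \<le> d k + C * (\<phi> (u (Suc k)) - \<phi> (u (Suc (Suc k))))"
    if "e (Suc k) < \<rho>" "k \<ge> m" for k
  proof -
    let ?\<Delta> = "\<phi> (u (Suc k)) - \<phi> (u (Suc (Suc k)))"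
    let ?p = "\<phi>' (u (Suc k))"
    have lt: "ereal (u (Suc k)) < \<eta>" using K(1) that m by simp
    have kl: "1 \<le> ?p * (b * d k)" by (rule KL[OF that(1) lt])
    \<comment> \<open>A step of length zero would contradict the Kurdyka-Lojasiewicz inequality.\<close>
    have dk: "d k > 0" using kl d[of k] by (cases "d k = 0") auto
    have p: "?p > 0"
      using kl dk \<open>b > 0\<close> by (meson less_le_trans mult_pos_pos zero_less_mult_pos2 zero_less_one)
    have "?p * (a * (d (Suc k))\<^sup>2) \<le> ?p * (u (Suc k) - u (Suc (Suc k)))"
      using descent[of "Suc k"] p by (intro mult_left_mono) auto
    also have "\<dots> \<le> ?\<Delta>"
      by (rule tangent) (use u(1) lt \<open>decseq u\<close> in \<open>auto simp: less_imp_le decseq_SucD\<close>)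
    finally have "(b * d k) * (?p * (a * (d (Suc k))\<^sup>2)) \<le> (b * d k) * ?\<Delta>"
      using \<open>b > 0\<close> dk by (intro mult_left_mono) auto
    moreover have "1 * (a * (d (Suc k))\<^sup>2) \<le> (?p * (b * d k)) * (a * (d (Suc k))\<^sup>2)"
      using kl \<open>a > 0\<close> by (intro mult_right_mono) auto
    ultimately have "a * (d (Suc k))\<^sup>2 \<le> (b * d k) * ?\<Delta>" by (simp add: mult_ac)
    then have sq: "(d (Suc k))\<^sup>2 \<le> d k * (C * ?\<Delta>)"
      using \<open>a > 0\<close> by (simp add: C_def field_simps)
    have nn: "0 \<le> C * ?\<Delta>"
      using order_trans[OF zero_le_power2 sq] dk by (simp add: zero_le_mult_iff)
    have "4 * (d k * (C * ?\<Delta>)) \<le> (d k + C * ?\<Delta>)\<^sup>2"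
      using zero_le_power2[of "d k - C * ?\<Delta>"] by (simp add: power2_eq_square algebra_simps)
    moreover have "(2 * d (Suc k))\<^sup>2 = 4 * (d (Suc k))\<^sup>2" by (simp only: power_mult_distrib) simp
    ultimately have "(2 * d (Suc k))\<^sup>2 \<le> (d k + C * ?\<Delta>)\<^sup>2" using sq by linarith
    moreover have "0 \<le> d k + C * ?\<Delta>" using dk nn by linarith
    ultimately show ?thesis by (rule power2_le_imp_le)
  qed
  define S where "S j = (\<Sum>i<j. d (Suc m + i))" for j
  \<comment> \<open>By \<open>step\<close>, the summand \<open>d (m + j)\<close> pays for two copies of the next step, up to a decrease of
    \<open>\<phi> \<circ> u\<close>: one copy enters \<open>S\<close>, the other replaces the summand.\<close>
  have main: "e (Suc m + j) \<le> e (Suc m) + S j \<and>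
      S j + d (m + j) \<le> d m + C * (\<phi> (u (Suc m)) - \<phi> (u (Suc m + j)))" for j
  proof (induction j)
    case 0
    then show ?case by (simp add: S_def)
  next
    case (Suc j)
    have "0 \<le> C * \<phi> (u (Suc m + j))"
      using C \<phi>(3) u(1) K(1)[of "Suc m + j"] m by (simp add: less_imp_le)
    then have "S j < \<rho> / 2"
      using Suc K(2)[OF m(1)] d[of "m + j"] by (simp add: right_diff_distrib)
    then have "e (Suc (m + j)) < \<rho>" using Suc m by simp
    from step[OF this] have
      "2 * d (Suc (m + j)) \<le> d (m + j) + C * (\<phi> (u (Suc (m + j))) - \<phi> (u (Suc (Suc (m + j)))))"
      by simp
    then show ?case using Suc e[of "Suc m + j"] by (simp add: S_def algebra_simps)
  qed
  have "S j \<le> d m + C * \<phi> (u (Suc m))" for j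
  proof -
    have "0 \<le> C * \<phi> (u (Suc m + j))"
      using C \<phi>(3) u(1) K(1)[of "Suc m + j"] m by (simp add: less_imp_le)
    then show ?thesis using main[of j] d[of "m + j"] by (simp add: right_diff_distrib)
  qed
  then have "summable (\<lambda>i. d (Suc m + i))"
    unfolding S_def using d by (intro summableI_nonneg_bounded) auto
  then show ?thesis using summable_iff_shift[of d "Suc m"] by (simp add: add.commute)
qed


section \<open>Convergence to a critical point\<close>

lemma lower_semicontinuous_le_limit:
  assumes "lower_semicontinuous f" and y: "(y \<longlongrightarrow> x) F" and "F \<noteq> bot"
    and "\<forall>\<^sub>F i in F. f (y i) \<le> L"
  shows "f x \<le> L"
proof (rule ccontr)
  assume "\<not> f x \<le> L"
  then have "\<forall>\<^sub>F z in nhds x. L < f z"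
    using assms(1) by (simp add: lower_semicontinuous_def not_le)
  from filterlim_iff[THEN iffD1, OF y, rule_format, OF this] assms(4)
  have "\<forall>\<^sub>F i in F. False" by eventually_elim simp
  with \<open>F \<noteq> bot\<close> show False by (simp add: trivial_limit_def)
qed

theorem theorem5p1:
  fixes A :: "('m::{t2_space, second_countable_topology}, 'n::finite) chart set"
    and g :: "('m, 'n) metric"
    and f :: "'m \<Rightarrow> ereal"
    and D :: "'m \<Rightarrow> 'm \<Rightarrow> real"
    and a b \<rho> :: real
    and x :: "nat \<Rightarrow> 'm"
    and xt :: 'm
    and U :: "'m set"
    and \<eta> :: ereal
    and \<phi> :: "real \<Rightarrow> real"
  assumes "complete_riemannian_manifold A g"
    and "proper f" and "lower_semicontinuous f"
    and "quasi_distance D" and "\<And>y. continuous_on UNIV (\<lambda>z. D z y)"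
    and "a > 0" and "b > 0"
    and "x 0 \<in> edom f" and "\<And>k. x (Suc k) \<noteq> x k"
    and "\<And>k. f (x (Suc k)) + ereal (a * (D (x (Suc k)) (x k))\<^sup>2) \<le> f (x k)"
    and "\<And>k. \<exists>w\<in>subdifferential A g f (x (Suc k)).
           tnorm g (x (Suc k)) w \<le> b * D (x (Suc k)) (x k)"
    and "continuous_on (edom f) f"
    and "summable (\<lambda>k. D (x (Suc k)) (x k)) \<Longrightarrow> convergent x"
    and "\<exists>r::nat \<Rightarrow> nat. strict_mono r \<and> (x \<circ> r) \<longlonglongrightarrow> xt"
    and "KL_property_with A g f xt U \<eta> \<phi>"
    and "\<rho> > 0" and "quasi_ball D xt \<rho> \<subseteq> U"
  shows "(\<exists>k\<^sub>0. summable (\<lambda>k. D (x (Suc (k\<^sub>0 + k))) (x (k\<^sub>0 + k)))) \<and>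
         (\<lambda>k. f (x k)) \<longlonglongrightarrow> f xt \<and>
         x \<longlonglongrightarrow> xt \<and>
         critical_point A g f xt"
proof -
  have A: "smooth_atlas A" and g: "riemannian_metric A g"
    using assms(1) unfolding complete_riemannian_manifold_def by blast+
  have D0: "0 \<le> D y z" and Dtri: "D y z \<le> D y y' + D y' z" and Drefl: "D y y = 0" for y y' z
    using assms(4) unfolding quasi_distance_def by blast+
  define d where "d k = D (x (Suc k)) (x k)" for k
  obtain r :: "nat \<Rightarrow> nat" where r: "strict_mono r" "(x \<circ> r) \<longlonglongrightarrow> xt" using assms(14) by blast
  have dec: "decseq (\<lambda>k. f (x k))"
  proof (rule decseq_SucI)
    fix k
    have "f (x (Suc k)) + 0 \<le> f (x (Suc k)) + ereal (a * (d k)\<^sup>2)"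
      using assms(6) by (intro add_left_mono) simp
    also have "\<dots> \<le> f (x k)" using assms(10)[of k] by (simp add: d_def)
    finally show "f (x (Suc k)) \<le> f (x k)" by simp
  qed
  have dom: "x k \<in> edom f" for k
    using assms(8) decseqD[OF dec, of 0 k] unfolding edom_def by (auto intro: le_less_trans)
  have xt_dom: "xt \<in> edom f"
  proof -
    have "f xt \<le> f (x 0)"
      by (rule lower_semicontinuous_le_limit[OF assms(3) r(2)]) (use decseqD[OF dec] in auto)
    then show ?thesis using assms(8) unfolding edom_def by (auto intro: le_less_trans)
  qed
  have flim: "(\<lambda>k. f (x k)) \<longlonglongrightarrow> f xt"
  proof -
    have "(\<lambda>k. f ((x \<circ> r) k)) \<longlonglongrightarrow> f xt"
      by (rule continuous_on_tendsto_compose[OF assms(12) r(2) xt_dom]) (simp add: dom)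
    moreover have L: "(\<lambda>k. f (x k)) \<longlonglongrightarrow> (INF k. f (x k))"
      by (rule LIMSEQ_INF[OF dec])
    moreover have "(\<lambda>k. f ((x \<circ> r) k)) \<longlonglongrightarrow> (INF k. f (x k))"
      using LIMSEQ_subseq_LIMSEQ[OF L r(1)] by (simp add: o_def)
    ultimately show ?thesis using LIMSEQ_unique by metis
  qed
  have fge: "f xt \<le> f (x k)" for k by (rule decseq_ge[OF dec flim])
  have fin: "\<bar>f z\<bar> \<noteq> \<infinity>" if "z \<in> edom f" for z
    using assms(2) that unfolding proper_def edom_def by auto
  define u where "u k = real_of_ereal (f (x k)) - real_of_ereal (f xt)" for k
  have fx: "f (x k) = f xt + ereal (u k)" for k
    using fin[OF dom, of k] fin[OF xt_dom] unfolding u_def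
    by (cases "f (x k)"; cases "f xt") auto
  obtain ft where ft: "f xt = ereal ft" using fin[OF xt_dom] by auto
  have u0: "0 \<le> u k" for k using fge[of k] fx[of k] by (simp add: ft)
  have ulim: "u \<longlonglongrightarrow> 0"
  proof -
    have "(\<lambda>k. ereal (ft + u k)) \<longlonglongrightarrow> ereal ft" using flim by (simp add: fx ft)
    then have "(\<lambda>k. ft + u k - ft) \<longlonglongrightarrow> ft - ft"
      by (intro tendsto_diff tendsto_const) simp
    then show ?thesis by simp
  qed
  have descent: "a * (d k)\<^sup>2 \<le> u k - u (Suc k)" for k
    using assms(10)[of k] by (simp add: fx ft d_def)
  have KL: "0 < \<eta>"
    "continuous_on {s. 0 \<le> s \<and> ereal s < \<eta>} \<phi>" "concave_on {s. 0 \<le> s \<and> ereal s < \<eta>} \<phi>"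
    "\<And>s. 0 \<le> s \<Longrightarrow> ereal s < \<eta> \<Longrightarrow> 0 \<le> \<phi> s" "\<phi> 0 = 0"
    "\<phi> C1_differentiable_on {s. 0 < s \<and> ereal s < \<eta>}"
    "\<And>s. 0 < s \<Longrightarrow> ereal s < \<eta> \<Longrightarrow> 0 < deriv \<phi> s"
    "\<And>x. x \<in> U \<Longrightarrow> f xt < f x \<Longrightarrow> f x < f xt + \<eta> \<Longrightarrow>
        1 \<le> ereal (deriv \<phi> (real_of_ereal (f x - f xt))) * dist_zero_subdifferential A g f x"
    using assms(15) unfolding KL_property_with_def by blast+
  obtain w where w: "\<And>k. w k \<in> subdifferential A g f (x (Suc k))"
    and wb: "\<And>k. tnorm g (x (Suc k)) (w k) \<le> b * d k"
    using assms(11) unfolding d_def by metis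
  have wT: "w k \<in> tangent_space A (x (Suc k))" for k
    using w[of k] by (simp add: subdifferential_def)
  \<comment> \<open>Even if the limit value is attained, the iterates keep moving, as a quasi distance can
    vanish in one direction; but all further steps then have length zero.\<close>
  have sum: "summable d"
  proof (cases "\<exists>K. u K = 0")
    case True
    then obtain K where K: "u K = 0" ..
    have uz: "u k = 0" if "k \<ge> K" for k
      using decseqD[OF dec that] u0[of k] K by (simp add: fx ft)
    have "d k = 0" if "k \<ge> K" for k
    proof -
      have "a * (d k)\<^sup>2 \<le> 0" using descent[of k] uz[of k] uz[of "Suc k"] that by simp
      then show ?thesis using assms(6) by (simp add: mult_le_0_iff)
    qed
    then show ?thesis by (intro summable_finite[of "{..<K}"]) (auto simp: not_less)
  next
    case False
    then have upos: "0 < u k" for k using u0[of k] by (metis order_less_le)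
    have Dlim: "(\<lambda>k. D (x (r k)) xt) \<longlonglongrightarrow> 0"
      using continuous_on_tendsto_compose[OF assms(5)[of xt] r(2)] by (simp add: Drefl)
    show ?thesis
    proof (rule summable_of_KL_descent[where e = "\<lambda>k. D (x k) xt" and \<phi> = \<phi> and \<phi>' = "deriv \<phi>"])
      show "D (x (Suc k)) xt \<le> d k + D (x k) xt" for k unfolding d_def by (rule Dtri)
      show "\<exists>\<^sub>F k in sequentially. D (x k) xt < \<epsilon>" if "\<epsilon> > 0" for \<epsilon>
        unfolding frequently_sequentially
      proof
        fix N
        have "\<forall>\<^sub>F k in sequentially. D (x (r k)) xt < \<epsilon> \<and> N \<le> k"
          by (intro eventually_conj order_tendstoD(2)[OF Dlim that] eventually_ge_at_top)
        then obtain k where "D (x (r k)) xt < \<epsilon>" "N \<le> k" by (auto simp: eventually_sequentially)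
        moreover have "N \<le> r k" using \<open>N \<le> k\<close> seq_suble[OF r(1), of k] by simp
        ultimately show "\<exists>n\<ge>N. D (x n) xt < \<epsilon>" by blast
      qed
      show "1 \<le> deriv \<phi> (u (Suc k)) * (b * d k)"
        if "D (x (Suc k)) xt < \<rho>" "ereal (u (Suc k)) < \<eta>" for k
      proof -
        let ?p = "deriv \<phi> (u (Suc k))"
        have p: "0 < ?p" by (rule KL(7)[OF upos that(2)])
        have "x (Suc k) \<in> U" using that(1) assms(17) by (auto simp: quasi_ball_def)
        moreover have "f xt < f (x (Suc k))" using upos[of "Suc k"] by (simp add: fx ft)
        moreover have "f (x (Suc k)) < f xt + \<eta>" using that(2) by (cases \<eta>) (auto simp: fx ft)
        ultimately have "1 \<le> ereal (deriv \<phi> (real_of_ereal (f (x (Suc k)) - f xt)))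
            * dist_zero_subdifferential A g f (x (Suc k))" by (rule KL(8))
        also have "real_of_ereal (f (x (Suc k)) - f xt) = u (Suc k)" by (simp add: fx ft)
        also have "ereal ?p * dist_zero_subdifferential A g f (x (Suc k))
            \<le> ereal ?p * ereal (tnorm g (x (Suc k)) (w k))"
          unfolding dist_zero_subdifferential_def
          by (intro ereal_mult_left_mono INF_lower w) (use p in simp)
        also have "\<dots> \<le> ereal (?p * (b * d k))" using wb[of k] p by simp
        finally show ?thesis by simp
      qed
    qed (use assms(6,7,16) KL D0 upos ulim descent in \<open>auto simp: d_def intro: concave_tangent_bound\<close>)
  qed
  have xlim: "x \<longlonglongrightarrow> xt"
  proof -
    have "convergent x" using assms(13) sum by (simp add: d_def[abs_def])
    then obtain l where l: "x \<longlonglongrightarrow> l" unfolding convergent_def by blast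
    then show ?thesis using LIMSEQ_subseq_LIMSEQ[OF l r(1)] r(2) LIMSEQ_unique by metis
  qed
  have crit: "tvec_zero \<in> subdifferential A g f xt"
  proof -
    obtain c where c: "c \<in> charts_at A xt"
      using A unfolding smooth_atlas_def charts_at_def by blast
    note xS = LIMSEQ_Suc[OF xlim]
    have bd: "(\<lambda>k. b * d k) \<longlonglongrightarrow> 0"
      by (rule tendsto_mult_right_zero[OF summable_LIMSEQ_zero[OF sum]])
    have "\<forall>\<^sub>F k in sequentially. norm (tnorm g (x (Suc k)) (w k)) \<le> b * d k"
      using tnorm_nonneg[OF A g wT] wb by simp
    from this bd have "(\<lambda>k. tnorm g (x (Suc k)) (w k)) \<longlonglongrightarrow> 0" by (rule Lim_null_comparison)
    from tnorm_tendsto_zero_coords[OF A g c xS wT this]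
    have "(\<lambda>k. w k c) \<longlonglongrightarrow> tvec_zero c" by (simp add: tvec_zero_def)
    from subdifferential_closed[OF A c tvec_zero_in_tangent_space[OF A] w xS this LIMSEQ_Suc[OF flim]]
    show ?thesis .
  qed
  have "summable (\<lambda>k. D (x (Suc (0 + k))) (x (0 + k)))" using sum by (simp add: d_def[abs_def])
  with flim xlim crit show ?thesis unfolding critical_point_def by blast
qed

end
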